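(* Let $b,p\in(0,\infty)$ and $\kappa\in\mathbb{N}$ (with $p\le1$ whenever $I_{\mathrm{G,MC}}$ is considered). The two rate functions $I_{\mathrm{G,MC}}$ and $I_{\mathrm{L,MC}}$ are both strictly convex and possess the same unique minimizer $$\big(a_{\mathrm{MC}}(p,\kappa),s_{\mathrm{MC}}(p,\kappa)\big)=\big(pb,\;pb\,e^{-bp/\kappa}\big).$$
   Context: Notation. $\mathbb{N}_0=\{0,1,2,\dots\}$; $\mathcal M_1(\mathcal X)$ is the set of probability measures on a discrete set $\mathcal X$; $\mathrm{Poi}_\alpha(k)=e^{-\alpha}\alpha^k/k!$; $H(\mu|\nu)=\sum_x\mu(x)\log\frac{\mu(x)}{\nu(x)}$ (relative entropy, with $0\log0=0$, and $+\infty$ if $\mu\not\ll\nu$); $\inf\emptyset=+\infty$. Let $\Xi=\{(i,j)\in\mathbb{N}_0^2\colon j\le i\text{ and }j\le\kappa\}$ and let $M$ be the probability measure on $\Xi$ given by $M(i,j)=\mathrm{Poi}_{bp/\kappa}^{\otimes\kappa}\big(\sum_{k=1}^\kappa X_k=i,\ \sum_{k=1}^\kappa\mathbf 1_{\{X_k=1\}}=j\big)$, where $X_1,\dots,X_\kappa$ are i.i.d. $\mathrm{Poi}_{bp/\kappa}$-distributed. The rate functions are defined for $(a,s)\in[0,\infty)^2$ by $$I_{\mathrm{L,MC}}(a,s)=\inf\Big\{H(\nu|M)\colon\nu\in\mathcal M_1(\Xi),\ \sum_{(i,j)\in\Xi}\nu(i,j)\,i=a,\ \sum_{(i,j)\in\Xi}\nu(i,j)\,j=s\Big\}$$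 and, for $p\le1$, $$I_{\mathrm{G,MC}}(a,s)=\kappa\inf\Big\{H(\mu|\mathrm{Poi}_{bp/\kappa})\colon\mu\in\mathcal M_1(\mathbb{N}_0),\ \sum_{g\in\mathbb{N}_0}\mu(g)g=\frac a\kappa,\ \mu(\{1\})=\frac s\kappa\Big\}+a-bp+(b-a)\log\frac{1-\frac ab}{1-p},$$ with the conventions that $I_{\mathrm{G,MC}}=+\infty$ for $a>b$, and that $(b-a)\log\frac{1-a/b}{1-p}$ is $0$ for $a=b$ and $+\infty$ if $p=1$ and $a<b$. Strict convexity of these $[0,\infty]$-valued functions is understood on the set where they are finite. (They are the large-deviation rate functions of $\frac1N$ times (number of attempts, number of successes) in the multi-channel slotted ALOHA model with local, resp. global, access rule.) *)

theory Defs
  imports "HOL-Probability.Probability"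
begin

(* Relative entropy of discrete distributions, with values in [0, \<infinity>].
   The convention 0 * ln 0 = 0 is automatic since 0 * _ = 0 on the reals.
   If \<mu> is absolutely continuous with respect to \<nu>, the negative parts of the summands are
   always summable (rel_entropy_neg_part_summable), so that the series either converges
   absolutely or has the value \<infinity>.  KL_divergence is not used because
   it is real-valued and returns 0 for divergent integrals. *)
definition rel_entropy :: "'a pmf \<Rightarrow> 'a pmf \<Rightarrow> ereal" where
  "rel_entropy \<mu> \<nu> =
     (if set_pmf \<mu> \<subseteq> set_pmf \<nu> \<and> (\<lambda>x. pmf \<mu> x * ln (pmf \<mu> x / pmf \<nu> x)) summable_on UNIV
      then ereal (\<Sum>\<^sub>\<infinity>x. pmf \<mu> x * ln (pmf \<mu> x / pmf \<nu> x))
      else \<infinity>)"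

lemma rel_entropy_neg_part_summable:
  assumes "set_pmf \<mu> \<subseteq> set_pmf \<nu>"
  shows "(\<lambda>x. max 0 (- (pmf \<mu> x * ln (pmf \<mu> x / pmf \<nu> x)))) summable_on UNIV"
proof (rule summable_on_comparison_test)
  show "pmf \<nu> summable_on UNIV"
    by (metis abs_summable_summable abs_summable_equivalent integrable_pmf abs_summable_on_def)
  show "max 0 (- (pmf \<mu> x * ln (pmf \<mu> x / pmf \<nu> x))) \<le> pmf \<nu> x" for x
  proof (cases "pmf \<mu> x = 0")
    case False
    then have pos: "pmf \<mu> x > 0" "pmf \<nu> x > 0"
      using assms by (auto simp: set_pmf_eq pmf_pos)
    have "- ln (pmf \<mu> x / pmf \<nu> x) = ln (pmf \<nu> x / pmf \<mu> x)"
      using pos by (simp add: ln_div)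
    also have "\<dots> \<le> pmf \<nu> x / pmf \<mu> x"
      using ln_bound[of "pmf \<nu> x / pmf \<mu> x"] pos by simp
    finally have "pmf \<mu> x * (- ln (pmf \<mu> x / pmf \<nu> x)) \<le> pmf \<mu> x * (pmf \<nu> x / pmf \<mu> x)"
      using pos by (intro mult_left_mono) auto
    then show ?thesis using pos by simp
  qed simp
qed simp

definition Xi :: "nat \<Rightarrow> (nat \<times> nat) set" where
  "Xi \<kappa> = {(i, j). j \<le> i \<and> j \<le> \<kappa>}"

definition M_MC :: "real \<Rightarrow> real \<Rightarrow> nat \<Rightarrow> (nat \<times> nat) pmf" where
  "M_MC b p \<kappa> =
     map_pmf (\<lambda>X. (\<Sum>k=1..\<kappa>. X k, \<Sum>k=1..\<kappa>. of_bool (X k = 1)))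
       (Pi_pmf {1..\<kappa>} 0 (\<lambda>_. poisson_pmf (b * p / real \<kappa>)))"

lemma set_pmf_M_MC: "set_pmf (M_MC b p \<kappa>) \<subseteq> Xi \<kappa>"
proof -
  have "(\<Sum>k=1..\<kappa>. of_bool (X k = 1)) \<le> (\<Sum>k=1..\<kappa>. X k)" for X :: "nat \<Rightarrow> nat"
    by (intro sum_mono) auto
  moreover have "(\<Sum>k=1..\<kappa>. of_bool (X k = 1)) \<le> \<kappa>" for X :: "nat \<Rightarrow> nat"
    using sum_mono[of "{1..\<kappa>}" "\<lambda>k. of_bool (X k = 1)" "\<lambda>_. 1 :: nat"] by simp
  ultimately show ?thesis by (auto simp: M_MC_def Xi_def)
qed

(* The rate functions are meant on the quadrant {0..} \<times> {0..}.  The infimum over the empty set is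
   \<infinity> in ereal; has_sum encodes that the (nonnegative) series converges to the given value. *)
definition I_LMC :: "real \<Rightarrow> real \<Rightarrow> nat \<Rightarrow> real \<times> real \<Rightarrow> ereal" where
  "I_LMC b p \<kappa> = (\<lambda>(a, s).
     INF \<nu> \<in> {\<nu>. set_pmf \<nu> \<subseteq> Xi \<kappa> \<and>
                 ((\<lambda>(i, j). pmf \<nu> (i, j) * real i) has_sum a) (Xi \<kappa>) \<and>
                 ((\<lambda>(i, j). pmf \<nu> (i, j) * real j) has_sum s) (Xi \<kappa>)}.
       rel_entropy \<nu> (M_MC b p \<kappa>))"

definition I_GMC :: "real \<Rightarrow> real \<Rightarrow> nat \<Rightarrow> real \<times> real \<Rightarrow> ereal" where
  "I_GMC b p \<kappa> = (\<lambda>(a, s).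
     if a > b then \<infinity>
     else ereal (real \<kappa>) *
            (INF \<mu> \<in> {\<mu>. ((\<lambda>g. pmf \<mu> g * real g) has_sum (a / real \<kappa>)) UNIV \<and>
                        pmf \<mu> 1 = s / real \<kappa>}.
               rel_entropy \<mu> (poisson_pmf (b * p / real \<kappa>)))
          + ereal (a - b * p)
          + (if a = b then 0
             else if p = 1 then \<infinity>
             else ereal ((b - a) * ln ((1 - a / b) / (1 - p)))))"

definition strictly_convex_on :: "'a::real_vector set \<Rightarrow> ('a \<Rightarrow> ereal) \<Rightarrow> bool" where
  "strictly_convex_on S f \<longleftrightarrow> convex S \<and>
     (\<forall>x\<in>S. \<forall>y\<in>S. \<forall>t. x \<noteq> y \<and> 0 < t \<and> t < 1 \<longrightarrow>
        f ((1 - t) *\<^sub>R x + t *\<^sub>R y) < ereal (1 - t) * f x + ereal t * f y)"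

abbreviation quadrant :: "(real \<times> real) set" where
  "quadrant \<equiv> {0..} \<times> {0..}"

definition finite_domain :: "(real \<times> real \<Rightarrow> ereal) \<Rightarrow> (real \<times> real) set" where
  "finite_domain I = {x \<in> quadrant. I x < \<infinity>}"

definition has_unique_minimizer :: "(real \<times> real \<Rightarrow> ereal) \<Rightarrow> real \<times> real \<Rightarrow> bool" where
  "has_unique_minimizer I m \<longleftrightarrow> (\<forall>x. is_arg_min I (\<lambda>y. y \<in> quadrant) x \<longleftrightarrow> x = m)"

end

theory Submission
  imports Defs
begin

text \<open>
  Both rate functions are built from one object: the minimal relative entropy
  \<open>J x = inf H(\<mu>|w)\<close> over all distributions \<open>\<mu>\<close> under which a statistic \<open>T\<close> has mean \<open>x\<close>
  (\<open>contracted_entropy\<close>). For the local rule, \<open>w\<close> is the law of (attempts, successes) and \<open>T\<close> is the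
  inclusion of \<open>\<nat>\<^sup>2\<close> in the plane. For the global rule, \<open>w\<close> is the Poisson law of a single channel,
  \<open>T g = (g, 1\<^bsub>g=1\<^esub>)\<close>, and the rate function is \<open>\<kappa> J(\<cdot>/\<kappa>)\<close> plus a function of \<open>a\<close> alone. With
  \<open>kl_term u w = u ln (u/w) - u + w\<close>, that extra term is \<open>kl_term (b - a) (b (1 - p))\<close> for \<open>p < 1\<close>, hence
  convex, nonnegative, and zero at \<open>a = pb\<close>; for \<open>p = 1\<close> it only restricts to \<open>a = b\<close>.

  The heart of the matter is the strict convexity of \<open>J\<close>. Relative entropy is strictly convex, but an
  infimum of strictly convex values need not be, unless it is attained. Instead of a compactness
  argument giving minimizers, the gap is bounded below uniformly. If \<open>\<mu>\<close> and \<open>\<nu>\<close> have means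
  \<open>x \<noteq> y\<close> and entropy at most \<open>C\<close>, then the convexity gap of the entropy at a mixture of \<open>\<mu>\<close> and \<open>\<nu>\<close>
  is at least some \<open>\<delta> > 0\<close> that depends only on \<open>x - y\<close>, \<open>C\<close>, \<open>t\<close> and the exponential moments of \<open>w\<close>
  (\<open>rel_entropy_mixture_gap_uniform\<close>); passing to nearly optimal \<open>\<mu>\<close> and \<open>\<nu>\<close> gives strict convexity.

  The bound on the gap comes from \<open>norm (x - y) \<le> \<Sum> norm (T z) \<bar>\<mu> z - \<nu> z\<bar>\<close>. Where \<open>norm (T z) \<le> K\<close>, the
  difference \<open>\<bar>\<mu> z - \<nu> z\<bar>\<close> is controlled by the gap through a Hellinger estimate. Where
  \<open>norm (T z) > K\<close>, Young's inequality \<open>u y \<le> kl_term u w + w e\<^sup>y\<close> bounds the contribution by the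
  entropies and an exponential moment of \<open>w\<close>, both with small factors.

  The minimizer follows at once: \<open>J \<ge> 0\<close>, with value \<open>0\<close> at the mean of \<open>w\<close>, and a strictly convex
  function has at most one minimizer.
\<close>

section \<open>A pointwise estimate for the convexity gap of relative entropy\<close>

text \<open>
  The summand of relative entropy, corrected by \<open>w - u\<close>. The correction sums to zero over probability
  distributions and makes every summand nonnegative.
\<close>
definition kl_term :: "real \<Rightarrow> real \<Rightarrow> real" where
  "kl_term u w = u * ln (u / w) - u + w"

lemma kl_term_self [simp]: "kl_term u u = 0"
  by (cases "u = 0") (auto simp: kl_term_def)

text \<open>
  With \<open>r = sqrt (w / u)\<close> this is \<open>ln r \<le> r - 1\<close>, multiplied by \<open>2 u\<close>.
\<close>
lemma hellinger_le_kl_term: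
  assumes "u \<ge> 0" "w \<ge> 0" "w = 0 \<Longrightarrow> u = 0"
  shows "(sqrt u - sqrt w)\<^sup>2 \<le> kl_term u w"
proof (cases "u = 0")
  case True
  then show ?thesis using assms by (simp add: kl_term_def)
next
  case False
  then have pos: "u > 0" "w > 0" using assms(1,2) assms(3) by (cases "w = 0"; simp)+
  define r where "r = sqrt w / sqrt u"
  have r: "r > 0" using pos by (simp add: r_def)
  have "ln (u / w) = - 2 * ln r"
    using pos by (simp add: r_def ln_div ln_sqrt)
  moreover have "ln r \<le> r - 1" using r by (rule ln_le_minus_one)
  ultimately have "u * ln (u / w) \<ge> u * (2 - 2 * r)"
    using pos by (intro mult_left_mono) auto
  moreover have "u * r = sqrt u * sqrt w"
    using pos by (simp add: r_def field_simps)
  ultimately show ?thesis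
    using pos by (simp add: kl_term_def power2_diff algebra_simps)
qed

lemma kl_term_nonneg:
  assumes "u \<ge> 0" "w \<ge> 0" "w = 0 \<Longrightarrow> u = 0"
  shows "kl_term u w \<ge> 0"
  using hellinger_le_kl_term[OF assms] by (meson order_trans zero_le_power2)

text \<open>
  The function \<open>u \<mapsto> u ln (u / w) - u\<close> and the function \<open>y \<mapsto> w exp y\<close> are convex conjugates; the proof
  is \<open>ln q \<le> q - 1\<close> for \<open>q = w exp y / u\<close>.
\<close>
lemma kl_term_young:
  assumes "u \<ge> 0" "w \<ge> 0" "w = 0 \<Longrightarrow> u = 0"
  shows "u * y \<le> kl_term u w + w * exp y"
proof (cases "u = 0")
  case True
  then show ?thesis using assms by (simp add: kl_term_def)
next
  case False
  then have pos: "u > 0" "w > 0" using assms(1,2) assms(3) by (cases "w = 0"; simp)+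
  have "ln (w * exp y / u) \<le> w * exp y / u - 1"
    using pos by (intro ln_le_minus_one) simp
  then have "u * (y - ln (u / w)) \<le> u * (w * exp y / u - 1)"
    using pos by (intro mult_left_mono) (simp_all add: ln_div ln_mult)
  then show ?thesis using pos by (simp add: kl_term_def algebra_simps)
qed

text \<open>
  The compensation identity: replacing the reference \<open>w\<close> by the mixture \<open>m\<close> changes \<open>kl_term z w\<close> by a
  term that is affine in \<open>z\<close>, and affine terms do not contribute to a convexity gap. Hence the gap does
  not depend on \<open>w\<close>.
\<close>
lemma kl_term_mixture:
  fixes t u v w :: real
  defines "m \<equiv> (1 - t) * u + t * v"
  assumes "0 < t" "t < 1" "u \<ge> 0" "v \<ge> 0" "w = 0 \<Longrightarrow> u = 0 \<and> v = 0" "w \<ge> 0"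
  shows "(1 - t) * kl_term u w + t * kl_term v w - kl_term m w
       = (1 - t) * kl_term u m + t * kl_term v m"
proof (cases "m = 0")
  case True
  have "(1 - t) * u \<ge> 0" "t * v \<ge> 0" using assms by auto
  then have "(1 - t) * u = 0" "t * v = 0" using True unfolding m_def by linarith+
  then have "u = 0" "v = 0" using assms by auto
  then show ?thesis using True by (simp add: kl_term_def algebra_simps)
next
  case False
  then have m: "m > 0" using assms by (simp add: m_def order_less_le)
  then have w: "w > 0" using assms by (cases "w = 0") (auto simp: m_def)
  have *: "kl_term z w = kl_term z m + z * ln (m / w) + w - m" if "z \<ge> 0" for z
    using that m w by (cases "z = 0") (auto simp: kl_term_def ln_div algebra_simps)
  define L where "L = ln (m / w)"
  have u: "kl_term u w = kl_term u m + u * L + w - m"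
    using *[OF assms(4)] by (simp only: L_def)
  have v: "kl_term v w = kl_term v m + v * L + w - m"
    using *[OF assms(5)] by (simp only: L_def)
  have m: "kl_term m w = ((1 - t) * u + t * v) * L + w - m"
    unfolding L_def m_def[symmetric] by (simp add: kl_term_def)
  show ?thesis
    unfolding u v m by algebra
qed

lemma kl_term_convex:
  assumes "0 < t" "t < 1" "u \<ge> 0" "v \<ge> 0" "w = 0 \<Longrightarrow> u = 0 \<and> v = 0" "w \<ge> 0"
  shows "kl_term ((1 - t) * u + t * v) w \<le> (1 - t) * kl_term u w + t * kl_term v w"
proof -
  define m where "m = (1 - t) * u + t * v"
  have nonneg: "(1 - t) * u \<ge> 0" "t * v \<ge> 0" using assms by auto
  have z: "u = 0 \<and> v = 0" if "m = 0"
  proof -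
    have "(1 - t) * u = 0" "t * v = 0" using nonneg that unfolding m_def by linarith+
    then show ?thesis using assms by auto
  qed
  have "m \<ge> 0" using nonneg by (simp add: m_def)
  then have "kl_term u m \<ge> 0" "kl_term v m \<ge> 0"
    using assms(3,4) z by (simp_all add: kl_term_nonneg)
  then have "0 \<le> (1 - t) * kl_term u m + t * kl_term v m"
    using assms(1,2) by simp
  then show ?thesis using kl_term_mixture[OF assms] unfolding m_def by linarith
qed

text \<open>
  By the compensation identity the gap dominates \<open>(1 - t) kl_term u m\<close>, and so, up to the factor
  \<open>1 - t\<close>, the square of \<open>A = \<bar>sqrt u - sqrt m\<bar>\<close>. On the other hand \<open>t \<bar>u - v\<bar> = \<bar>u - m\<bar>\<close> factors as
  \<open>A (sqrt u + sqrt m)\<close>. The parameter \<open>\<epsilon>\<close> trades the two factors, so that the bound stays linear in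
  the gap and can be summed.
\<close>
lemma abs_diff_le_mixture_gap:
  fixes t u v w :: real
  defines "m \<equiv> (1 - t) * u + t * v"
  assumes t: "0 < t" "t < 1" and uv: "u \<ge> 0" "v \<ge> 0"
    and w: "w = 0 \<Longrightarrow> u = 0 \<and> v = 0" "w \<ge> 0" and e: "\<epsilon> > 0"
  defines "G \<equiv> (1 - t) * kl_term u w + t * kl_term v w - kl_term m w"
  shows "t * \<bar>u - v\<bar> \<le> \<epsilon> * (u + m) + G / (2 * \<epsilon> * (1 - t))"
proof -
  have nonneg: "(1 - t) * u \<ge> 0" "t * v \<ge> 0" using assms by auto
  have m: "m \<ge> 0" using nonneg by (simp add: m_def)
  have z: "u = 0 \<and> v = 0" if "m = 0"
  proof -
    have "(1 - t) * u = 0" "t * v = 0" using nonneg that unfolding m_def by linarith+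
    then show ?thesis using assms by auto
  qed
  have "kl_term v m \<ge> 0" using uv m z by (intro kl_term_nonneg) auto
  then have "t * kl_term v m \<ge> 0" using t by simp
  then have G: "(1 - t) * kl_term u m \<le> G"
    using kl_term_mixture[OF t uv w] by (simp add: G_def m_def)
  define A B where "A = \<bar>sqrt u - sqrt m\<bar>" and "B = sqrt u + sqrt m"
  have "A * B = \<bar>u - m\<bar>"
  proof -
    have "A * B = \<bar>(sqrt u - sqrt m) * B\<bar>"
      using uv m by (simp add: A_def B_def abs_mult)
    also have "(sqrt u - sqrt m) * B = u - m"
      using uv m by (simp add: B_def algebra_simps)
    finally show ?thesis .
  qed
  also have "u - m = t * (u - v)" by (simp add: m_def algebra_simps)
  finally have AB: "A * B = t * \<bar>u - v\<bar>" using t by (simp add: abs_mult)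
  have "0 \<le> (\<epsilon> * B - A)\<^sup>2" by simp
  then have "2 * \<epsilon> * (A * B) \<le> \<epsilon>\<^sup>2 * B\<^sup>2 + A\<^sup>2"
    by (simp add: power2_diff power_mult_distrib mult_ac)
  moreover have "B\<^sup>2 \<le> 2 * (u + m)"
  proof -
    have "0 \<le> (sqrt u - sqrt m)\<^sup>2" by simp
    then show ?thesis using uv m by (simp add: B_def power2_diff power2_sum)
  qed
  then have "\<epsilon>\<^sup>2 * B\<^sup>2 \<le> \<epsilon>\<^sup>2 * (2 * (u + m))" by (rule mult_left_mono) simp
  moreover have "A\<^sup>2 \<le> kl_term u m"
    using hellinger_le_kl_term[of u m] uv m z by (simp add: A_def)
  moreover have "kl_term u m \<le> G / (1 - t)"
    using G t by (simp add: pos_le_divide_eq mult.commute)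
  ultimately have "2 * \<epsilon> * (t * \<bar>u - v\<bar>) \<le> \<epsilon>\<^sup>2 * (2 * (u + m)) + G / (1 - t)"
    unfolding AB by linarith
  also have "\<dots> = 2 * \<epsilon> * (\<epsilon> * (u + m) + G / (2 * \<epsilon> * (1 - t)))"
    using e by (simp add: distrib_left power2_eq_square)
  finally show ?thesis using e by (simp only: mult_le_cancel_left_pos mult_pos_pos zero_less_numeral)
qed

text \<open>
  In the application \<open>N\<close> is the norm of the statistic at a point, and \<open>K\<close> the truncation level that
  separates the Hellinger estimate from the tail estimate. Raising the exponent from \<open>c\<close> to \<open>c + 1\<close>
  buys the factor \<open>exp (- K)\<close> in the tail.
\<close>
lemma weighted_diff_le_mixture_gap:
  fixes t u v w :: real
  defines "m \<equiv> (1 - t) * u + t * v"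
  assumes t: "0 < t" "t < 1" and uv: "u \<ge> 0" "v \<ge> 0"
    and w: "w = 0 \<Longrightarrow> u = 0 \<and> v = 0" "w \<ge> 0" and e: "\<epsilon> > 0"
  defines "G \<equiv> (1 - t) * kl_term u w + t * kl_term v w - kl_term m w"
  assumes N: "N \<ge> 0" and K: "K \<ge> 0" and l: "c > 0"
  shows "N * \<bar>u - v\<bar> \<le> K / t * (\<epsilon> * (u + m) + G / (2 * \<epsilon> * (1 - t)))
           + (kl_term u w + kl_term v w + 2 * exp (- K) * (w * exp ((c + 1) * N))) / c"
proof -
  define R where "R = \<epsilon> * (u + m) + G / (2 * \<epsilon> * (1 - t))"
  have R: "t * \<bar>u - v\<bar> \<le> R"
    unfolding R_def m_def G_def by (rule abs_diff_le_mixture_gap[OF t uv w e])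
  have "0 \<le> t * \<bar>u - v\<bar>" using t by simp
  with R have R0: "R \<ge> 0" by linarith
  have kl: "kl_term u w \<ge> 0" "kl_term v w \<ge> 0"
    using uv w by (auto intro!: kl_term_nonneg)
  show ?thesis unfolding R_def[symmetric]
  proof (cases "N \<le> K")
    case True
    have "N * \<bar>u - v\<bar> \<le> K * \<bar>u - v\<bar>" using True by (intro mult_right_mono) auto
    also have "\<dots> = K / t * (t * \<bar>u - v\<bar>)" using t by simp
    also have "\<dots> \<le> K / t * R" using R K t by (intro mult_left_mono) auto
    finally show "N * \<bar>u - v\<bar> \<le> K / t * R + (kl_term u w + kl_term v w
        + 2 * exp (- K) * (w * exp ((c + 1) * N))) / c"
      using kl w l by (intro add_increasing2 divide_nonneg_pos) auto
  next
    case False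
    have tail: "c * (z * N) \<le> kl_term z w + exp (- K) * (w * exp ((c + 1) * N))"
      if "z \<ge> 0" "w = 0 \<Longrightarrow> z = 0" for z
    proof -
      have "z * (c * N) \<le> kl_term z w + w * exp (c * N)"
        using that w by (intro kl_term_young) auto
      also have "w * exp (c * N) \<le> w * (exp (- K) * exp ((c + 1) * N))"
        using False w by (intro mult_left_mono) (simp_all add: mult_exp_exp algebra_simps)
      finally show ?thesis by (simp add: mult_ac)
    qed
    have "c * (N * \<bar>u - v\<bar>) \<le> c * (u * N) + c * (v * N)"
    proof -
      have "c * (N * \<bar>u - v\<bar>) \<le> c * (N * (u + v))"
        using uv N l by (intro mult_left_mono) auto
      then show ?thesis by (simp add: algebra_simps)
    qed
    also have "\<dots> \<le> kl_term u w + kl_term v w + 2 * exp (- K) * (w * exp ((c + 1) * N))"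
      using tail[of u] tail[of v] uv w by simp
    finally have "N * \<bar>u - v\<bar> \<le> (kl_term u w + kl_term v w
        + 2 * exp (- K) * (w * exp ((c + 1) * N))) / c"
      using l by (simp add: pos_le_divide_eq mult.commute)
    moreover have "0 \<le> K / t * R" using K t R0 by simp
    ultimately show "N * \<bar>u - v\<bar> \<le> K / t * R + (kl_term u w + kl_term v w
        + 2 * exp (- K) * (w * exp ((c + 1) * N))) / c" by linarith
  qed
qed

section \<open>Relative entropy under mixing\<close>

lemma has_sum_diff:
  fixes f g :: "'a \<Rightarrow> 'b::real_normed_vector"
  assumes "(f has_sum x) A" "(g has_sum y) A"
  shows "((\<lambda>z. f z - g z) has_sum (x - y)) A"
proof -
  have "sum (\<lambda>z. f z - g z) = (\<lambda>F. sum f F - sum g F)"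
    by (simp add: fun_eq_iff sum_subtractf)
  then show ?thesis
    using assms by (simp only: has_sum_def tendsto_diff)
qed

lemma pmf_has_sum_1: "(pmf \<mu> has_sum 1) UNIV"
proof -
  have "Infinite_Set_Sum.abs_summable_on (pmf \<mu>) UNIV" by (rule pmf_abs_summable)
  then have "Infinite_Sum.abs_summable_on (pmf \<mu>) UNIV" "infsetsum (pmf \<mu>) UNIV = infsum (pmf \<mu>) UNIV"
    by (simp_all only: abs_summable_equivalent infsetsum_infsum)
  moreover have "infsetsum (pmf \<mu>) UNIV = 1" by (simp add: infsetsum_pmf_eq_1)
  ultimately show ?thesis by (simp add: has_sum_iff abs_summable_summable)
qed

lemma pmf_has_sum_expectation:
  fixes f :: "'a \<Rightarrow> real"
  assumes "integrable (measure_pmf \<mu>) f"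
  shows "((\<lambda>z. pmf \<mu> z * f z) has_sum measure_pmf.expectation \<mu> f) UNIV"
proof -
  have "integrable (density (count_space UNIV) (pmf \<mu>)) f"
    using assms by (simp add: measure_pmf_eq_density)
  then have "Infinite_Set_Sum.abs_summable_on (\<lambda>z. pmf \<mu> z * f z) UNIV"
    by (subst (asm) integrable_density) (auto simp: Infinite_Set_Sum.abs_summable_on_def)
  then have "Infinite_Sum.abs_summable_on (\<lambda>z. pmf \<mu> z * f z) UNIV"
    "infsetsum (\<lambda>z. pmf \<mu> z * f z) UNIV = infsum (\<lambda>z. pmf \<mu> z * f z) UNIV"
    by (simp_all only: abs_summable_equivalent infsetsum_infsum)
  then show ?thesis 
    by (simp only: has_sum_iff abs_summable_summable pmf_expectation_eq_infsetsum)
qed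

lemma pmf_abs_cont: "set_pmf \<mu> \<subseteq> set_pmf w \<Longrightarrow> pmf w z = 0 \<Longrightarrow> pmf \<mu> z = 0"
  by (auto simp: set_pmf_eq)

text \<open>
  Finite values of the relative entropy are sums of the nonnegative terms \<open>kl_term\<close>: the two correction
  terms \<open>- pmf \<mu>\<close> and \<open>pmf w\<close> sum to \<open>-1\<close> and \<open>1\<close>.
\<close>
lemma rel_entropy_eq_ereal_iff:
  "rel_entropy \<mu> w = ereal h \<longleftrightarrow>
     set_pmf \<mu> \<subseteq> set_pmf w \<and> ((\<lambda>z. kl_term (pmf \<mu> z) (pmf w z)) has_sum h) UNIV"
proof -
  let ?f = "\<lambda>z. pmf \<mu> z * ln (pmf \<mu> z / pmf w z)"
  let ?k = "\<lambda>z. kl_term (pmf \<mu> z) (pmf w z)"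
  have "(?k has_sum h) UNIV" if "(?f has_sum h) UNIV"
    using has_sum_add[OF has_sum_diff[OF that pmf_has_sum_1[of \<mu>]] pmf_has_sum_1[of w]]
    by (simp add: kl_term_def)
  moreover have "(?f has_sum h) UNIV" if "(?k has_sum h) UNIV"
    using has_sum_add[OF has_sum_diff[OF that pmf_has_sum_1[of w]] pmf_has_sum_1[of \<mu>]]
    by (simp add: kl_term_def)
  ultimately have "(?f has_sum h) UNIV \<longleftrightarrow> (?k has_sum h) UNIV" by blast
  then show ?thesis
    unfolding rel_entropy_def by (auto simp: has_sum_iff)
qed

lemma rel_entropy_neq_MInf: "rel_entropy \<mu> w \<noteq> - \<infinity>"
  by (simp add: rel_entropy_def)

lemma rel_entropy_nonneg: "rel_entropy \<mu> w \<ge> 0"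
proof (cases "rel_entropy \<mu> w")
  case (real h)
  then have ac: "set_pmf \<mu> \<subseteq> set_pmf w"
    and h: "((\<lambda>z. kl_term (pmf \<mu> z) (pmf w z)) has_sum h) UNIV"
    by (simp_all add: rel_entropy_eq_ereal_iff)
  have "h \<ge> 0"
    by (rule has_sum_nonneg[OF h], rule kl_term_nonneg) (use pmf_abs_cont[OF ac] in auto)
  then show ?thesis using real by simp
qed (simp_all add: rel_entropy_neq_MInf)

lemma rel_entropy_self: "rel_entropy w w = 0"
  using rel_entropy_eq_ereal_iff[of w w 0] by (simp add: zero_ereal_def)

definition mix_pmf :: "real \<Rightarrow> 'a pmf \<Rightarrow> 'a pmf \<Rightarrow> 'a pmf" where
  "mix_pmf t \<mu> \<nu> = bernoulli_pmf t \<bind> (\<lambda>B. if B then \<nu> else \<mu>)"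

lemma pmf_mix:
  assumes "0 < t" "t < 1"
  shows "pmf (mix_pmf t \<mu> \<nu>) z = (1 - t) * pmf \<mu> z + t * pmf \<nu> z"
  using assms by (simp add: mix_pmf_def pmf_bind)

lemma mix_pmf_moment:
  fixes T :: "'a \<Rightarrow> 'b::real_normed_vector"
  assumes t: "0 < t" "t < 1"
    and x: "((\<lambda>z. pmf \<mu> z *\<^sub>R T z) has_sum x) UNIV"
    and y: "((\<lambda>z. pmf \<nu> z *\<^sub>R T z) has_sum y) UNIV"
  shows "((\<lambda>z. pmf (mix_pmf t \<mu> \<nu>) z *\<^sub>R T z) has_sum ((1 - t) *\<^sub>R x + t *\<^sub>R y)) UNIV"
  using has_sum_add[OF has_sum_scaleR[OF x, of "1 - t"] has_sum_scaleR[OF y, of t]] t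
  by (simp add: pmf_mix scaleR_add_left)

text \<open>
  The pointwise estimate \<open>weighted_diff_le_mixture_gap\<close> summed over all points, with
  \<open>N = norm (T z)\<close>. The number \<open>(1 - t) * h + t * k - l\<close> is the convexity gap of the entropy.
\<close>
lemma rel_entropy_mixture_gap:
  fixes T :: "'a \<Rightarrow> 'b::real_normed_vector"
  assumes t: "0 < t" "t < 1"
    and H\<mu>: "rel_entropy \<mu> w = ereal h" and H\<nu>: "rel_entropy \<nu> w = ereal k"
    and x: "((\<lambda>z. pmf \<mu> z *\<^sub>R T z) has_sum x) UNIV"
    and y: "((\<lambda>z. pmf \<nu> z *\<^sub>R T z) has_sum y) UNIV"
    and K: "K \<ge> 0" and e: "\<epsilon> > 0" and c: "c > 0"
    and Z: "((\<lambda>z. pmf w z * exp ((c + 1) * norm (T z))) has_sum Z) UNIV"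
  obtains l where "rel_entropy (mix_pmf t \<mu> \<nu>) w = ereal l"
    "norm (x - y) \<le> K / t * (2 * \<epsilon> + ((1 - t) * h + t * k - l) / (2 * \<epsilon> * (1 - t)))
           + (h + k + 2 * exp (- K) * Z) / c"
proof -
  let ?m = "mix_pmf t \<mu> \<nu>"
  let ?h = "\<lambda>z. kl_term (pmf \<mu> z) (pmf w z)"
  let ?k = "\<lambda>z. kl_term (pmf \<nu> z) (pmf w z)"
  let ?l = "\<lambda>z. kl_term (pmf ?m z) (pmf w z)"
  have ac: "set_pmf \<mu> \<subseteq> set_pmf w" "set_pmf \<nu> \<subseteq> set_pmf w"
    and h: "(?h has_sum h) UNIV" and k: "(?k has_sum k) UNIV"
    using H\<mu> H\<nu> by (auto simp: rel_entropy_eq_ereal_iff)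
  have ac0: "pmf \<mu> z = 0 \<and> pmf \<nu> z = 0" if "pmf w z = 0" for z
    using ac that by (auto dest: pmf_abs_cont)
  have acm: "set_pmf ?m \<subseteq> set_pmf w"
    using ac0 by (auto simp: set_pmf_eq pmf_mix[OF t])
  have le: "?l z \<le> (1 - t) * ?h z + t * ?k z" for z
    using kl_term_convex[OF t, of "pmf \<mu> z" "pmf \<nu> z" "pmf w z"] ac0[of z]
    by (simp add: pmf_mix[OF t])
  have hk: "((\<lambda>z. (1 - t) * ?h z + t * ?k z) has_sum ((1 - t) * h + t * k)) UNIV"
    by (intro has_sum_add has_sum_cmult_right h k)
  have "?l summable_on UNIV"
    by (rule summable_on_comparison_test[OF has_sum_imp_summable[OF hk] le], rule kl_term_nonneg)
      (use pmf_abs_cont[OF acm] in auto)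
  then obtain l where l: "(?l has_sum l) UNIV" by (auto simp: summable_on_def)
  have ent: "rel_entropy ?m w = ereal l"
    using l acm by (simp add: rel_entropy_eq_ereal_iff)
  define G where "G = (\<lambda>z. (1 - t) * ?h z + t * ?k z - ?l z)"
  have G: "(G has_sum ((1 - t) * h + t * k - l)) UNIV"
    unfolding G_def by (intro has_sum_diff hk l)
  define R where "R = (\<lambda>z. K / t * (\<epsilon> * (pmf \<mu> z + pmf ?m z) + G z / (2 * \<epsilon> * (1 - t)))
           + (?h z + ?k z + 2 * exp (- K) * (pmf w z * exp ((c + 1) * norm (T z)))) / c)"
  have R: "(R has_sum (K / t * (\<epsilon> * (1 + 1) + ((1 - t) * h + t * k - l) / (2 * \<epsilon> * (1 - t)))
           + (h + k + 2 * exp (- K) * Z) / c)) UNIV"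
    unfolding R_def divide_inverse
    by (intro has_sum_add has_sum_cmult_right has_sum_cmult_left G h k Z pmf_has_sum_1)
  have D: "((\<lambda>z. pmf \<mu> z *\<^sub>R T z - pmf \<nu> z *\<^sub>R T z) has_sum (x - y)) UNIV"
    by (intro has_sum_diff x y)
  have le_R: "norm (pmf \<mu> z *\<^sub>R T z - pmf \<nu> z *\<^sub>R T z) \<le> R z" for z
  proof -
    have "norm (pmf \<mu> z *\<^sub>R T z - pmf \<nu> z *\<^sub>R T z) = norm (T z) * \<bar>pmf \<mu> z - pmf \<nu> z\<bar>"
      by (simp add: scaleR_diff_left[symmetric])
    also have "\<dots> \<le> R z"
      using weighted_diff_le_mixture_gap[OF t, of "pmf \<mu> z" "pmf \<nu> z" "pmf w z" \<epsilon> "norm (T z)" K c]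
        ac0[of z] K c e by (simp add: R_def G_def pmf_mix[OF t])
    finally show ?thesis .
  qed
  have "norm (x - y) \<le> K / t * (\<epsilon> * (1 + 1) + ((1 - t) * h + t * k - l) / (2 * \<epsilon> * (1 - t)))
           + (h + k + 2 * exp (- K) * Z) / c"
    using D R le_R by (rule norm_infsum_le)
  also have "\<epsilon> * (1 + 1) = 2 * \<epsilon>" by simp
  finally show ?thesis by (rule that[OF ent])
qed

text \<open>
  In the bound for \<open>d = norm (x - y)\<close> from \<open>rel_entropy_mixture_gap\<close>, the parameters \<open>c\<close>, \<open>K\<close> and
  \<open>\<epsilon>\<close> are chosen in this order such that the entropy term, the exponential moment and the \<open>\<epsilon>\<close>-term are
  each at most \<open>d / 4\<close>. The remaining term, which is a multiple of the gap, then has to account for the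
  last quarter of \<open>d\<close>.
\<close>
lemma rel_entropy_mixture_gap_uniform:
  fixes T :: "'a \<Rightarrow> 'b::real_normed_vector"
  assumes t: "0 < t" "t < 1" and "x \<noteq> y" and "C \<ge> 0"
    and exp_moments: "\<And>c. c > 0 \<Longrightarrow> (\<lambda>z. pmf w z * exp (c * norm (T z))) summable_on UNIV"
  shows "\<exists>\<delta>>0. \<forall>\<mu> \<nu> h k. rel_entropy \<mu> w = ereal h \<longrightarrow> rel_entropy \<nu> w = ereal k \<longrightarrow>
      h \<le> C \<longrightarrow> k \<le> C \<longrightarrow>
      ((\<lambda>z. pmf \<mu> z *\<^sub>R T z) has_sum x) UNIV \<longrightarrow> ((\<lambda>z. pmf \<nu> z *\<^sub>R T z) has_sum y) UNIV \<longrightarrow>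
      rel_entropy (mix_pmf t \<mu> \<nu>) w \<le> ereal ((1 - t) * h + t * k - \<delta>)"
proof -
  define d where "d = norm (x - y)"
  have d: "d > 0" using \<open>x \<noteq> y\<close> by (simp add: d_def)
  define c where "c = (8 * C + 1) / d"
  have c: "c > 0" using d \<open>C \<ge> 0\<close> by (simp add: c_def)
  have "2 * C \<le> d / 4 * c" using d by (simp add: c_def)
  then have cC: "2 * C / c \<le> d / 4" using c by (simp add: pos_divide_le_eq)
  obtain Z where Z: "((\<lambda>z. pmf w z * exp ((c + 1) * norm (T z))) has_sum Z) UNIV"
    using exp_moments[of "c + 1"] c by (auto simp: summable_on_def)
  have Z0: "Z \<ge> 0" by (rule has_sum_nonneg[OF Z]) simp
  define K where "K = ln (8 * Z / (c * d) + 1)"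
  have Zcd: "8 * Z / (c * d) \<ge> 0" using Z0 c d by simp
  have K: "K \<ge> 0" using Zcd by (simp add: K_def)
  have KZ: "2 * exp (- K) * Z / c \<le> d / 4"
  proof -
    have "8 * Z / (c * d) \<le> exp K" using Zcd by (simp add: K_def)
    then have "8 * Z \<le> exp K * (c * d)" using c d by (simp only: pos_divide_le_eq mult_pos_pos)
    then have "exp (- K) * (8 * Z) \<le> exp (- K) * (exp K * (c * d))"
      by (intro mult_left_mono) auto
    also have "\<dots> = c * d" by (simp add: mult.assoc[symmetric] mult_exp_exp)
    finally have "2 * exp (- K) * Z \<le> d / 4 * c" by (simp add: mult_ac)
    then show ?thesis using c by (simp only: pos_divide_le_eq)
  qed
  define \<epsilon> where "\<epsilon> = t * d / (8 * (K + 1))"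
  have e: "\<epsilon> > 0" using t d K by (simp add: \<epsilon>_def)
  have "K / t * (2 * \<epsilon>) = d / 4 * (K / (K + 1))" using t K by (simp add: \<epsilon>_def divide_simps)
  also have "\<dots> \<le> d / 4 * 1" using d K by (intro mult_left_mono) auto
  finally have eK: "K / t * (2 * \<epsilon>) \<le> d / 4" by simp
  define q where "q = 2 * \<epsilon> * t * (1 - t)"
  have q: "q > 0" using e t by (simp add: q_def)
  define \<delta> where "\<delta> = d / 4 * q / (K + 1)"
  have \<delta>: "\<delta> > 0" using d q K by (simp add: \<delta>_def)
  show ?thesis
  proof (intro exI[of _ \<delta>] conjI allI impI \<delta>)
    fix \<mu> \<nu> h k
    assume H: "rel_entropy \<mu> w = ereal h" "rel_entropy \<nu> w = ereal k" "h \<le> C" "k \<le> C"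
      "((\<lambda>z. pmf \<mu> z *\<^sub>R T z) has_sum x) UNIV" "((\<lambda>z. pmf \<nu> z *\<^sub>R T z) has_sum y) UNIV"
    obtain l where l: "rel_entropy (mix_pmf t \<mu> \<nu>) w = ereal l" and
      "d \<le> K / t * (2 * \<epsilon> + ((1 - t) * h + t * k - l) / (2 * \<epsilon> * (1 - t)))
           + (h + k + 2 * exp (- K) * Z) / c"
      using rel_entropy_mixture_gap[OF t H(1,2,5,6) K e c Z] unfolding d_def by blast
    note bound = this(2)
    define g where "g = (1 - t) * h + t * k - l"
    define X where "X = g / (2 * \<epsilon> * (1 - t))"
    have "(h + k + 2 * exp (- K) * Z) / c \<le> 2 * C / c + 2 * exp (- K) * Z / c"
      unfolding add_divide_distrib[symmetric] using H(3,4) c by (intro divide_right_mono) auto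
    then have "d \<le> K / t * (2 * \<epsilon> + X) + (d / 4 + d / 4)"
      using bound cC KZ unfolding g_def[symmetric] X_def[symmetric] by linarith
    moreover have "K / t * (2 * \<epsilon> + X) = K / t * (2 * \<epsilon>) + K / t * X"
      by (rule distrib_left)
    ultimately have gap: "d / 4 \<le> K / t * X" using eK by linarith
    have "K / t * X = K * g / q" by (simp add: X_def q_def)
    with gap have "d / 4 \<le> K * g / q" by (simp only:)
    then have "d / 4 * q \<le> K * g" by (simp only: pos_le_divide_eq[OF q])
    moreover have "0 < d / 4 * q" using d q by simp
    ultimately have Kg: "0 < K * g" "d / 4 * q \<le> K * g" by linarith+
    then have "g > 0" using K by (auto simp: zero_less_mult_iff)
    then have "d / 4 * q \<le> g * (K + 1)" using Kg(2) by (simp only: distrib_left) (simp add: mult.commute)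
    then have "\<delta> \<le> g" unfolding \<delta>_def using K by (subst pos_divide_le_eq) simp_all
    then show "rel_entropy (mix_pmf t \<mu> \<nu>) w \<le> ereal ((1 - t) * h + t * k - \<delta>)"
      using l by (simp add: g_def)
  qed
qed

section \<open>Minimal relative entropy under a mean constraint\<close>

text \<open>
  The rate function that the contraction principle derives from Sanov's theorem for the empirical mean
  of \<open>T\<close> under samples from \<open>w\<close>.
\<close>
definition contracted_entropy :: "'a pmf \<Rightarrow> ('a \<Rightarrow> 'b::real_normed_vector) \<Rightarrow> 'b \<Rightarrow> ereal" where
  "contracted_entropy w T x =
     (INF \<mu> \<in> {\<mu>. ((\<lambda>z. pmf \<mu> z *\<^sub>R T z) has_sum x) UNIV}. rel_entropy \<mu> w)"

lemma contracted_entropy_nonneg: "contracted_entropy w T x \<ge> 0"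
  unfolding contracted_entropy_def by (intro INF_greatest rel_entropy_nonneg)

lemma contracted_entropy_mean:
  assumes "((\<lambda>z. pmf w z *\<^sub>R T z) has_sum x) UNIV"
  shows "contracted_entropy w T x = 0"
proof (rule antisym)
  show "contracted_entropy w T x \<le> 0"
    unfolding contracted_entropy_def using assms by (intro INF_lower2[of w]) (auto simp: rel_entropy_self)
qed (rule contracted_entropy_nonneg)

lemma contracted_entropy_approx:
  assumes "contracted_entropy w T x = ereal j" "\<eta> > 0"
  obtains \<mu> h where "rel_entropy \<mu> w = ereal h" "h < j + \<eta>" "((\<lambda>z. pmf \<mu> z *\<^sub>R T z) has_sum x) UNIV"
proof -
  have "contracted_entropy w T x < ereal (j + \<eta>)" using assms by simp
  then obtain \<mu> where \<mu>: "rel_entropy \<mu> w < ereal (j + \<eta>)" "((\<lambda>z. pmf \<mu> z *\<^sub>R T z) has_sum x) UNIV"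
    by (auto simp: contracted_entropy_def INF_less_iff)
  then show ?thesis
    using rel_entropy_nonneg[of \<mu> w] by (cases "rel_entropy \<mu> w") (auto intro: that)
qed

text \<open>
  Nearly optimal \<open>\<mu>\<close> for \<open>x\<close> and \<open>\<nu>\<close> for \<open>y\<close> have bounded entropy, so the uniform gap \<open>\<delta>\<close> applies to
  their mixture. An optimality defect \<open>\<eta> \<le> \<delta>\<close> does not use up this gap. The bound \<open>\<eta> \<le> 1\<close> keeps both
  entropies below \<open>i + j + 1\<close>, so that \<open>\<delta>\<close> can be fixed before \<open>\<mu>\<close> and \<open>\<nu>\<close>.
\<close>
theorem contracted_entropy_strict_convex:
  fixes T :: "'a \<Rightarrow> 'b::real_normed_vector"
  assumes exp_moments: "\<And>c. c > 0 \<Longrightarrow> (\<lambda>z. pmf w z * exp (c * norm (T z))) summable_on UNIV"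
    and x: "contracted_entropy w T x = ereal i" and y: "contracted_entropy w T y = ereal j"
    and "x \<noteq> y" and t: "0 < t" "t < 1"
  shows "contracted_entropy w T ((1 - t) *\<^sub>R x + t *\<^sub>R y) < ereal ((1 - t) * i + t * j)"
proof -
  have ij: "i \<ge> 0" "j \<ge> 0"
    using x y contracted_entropy_nonneg[of w T x] contracted_entropy_nonneg[of w T y] by simp_all
  obtain \<delta> where \<delta>: "\<delta> > 0" and gap:
    "\<forall>\<mu> \<nu> h k. rel_entropy \<mu> w = ereal h \<longrightarrow> rel_entropy \<nu> w = ereal k \<longrightarrow>
      h \<le> i + j + 1 \<longrightarrow> k \<le> i + j + 1 \<longrightarrow>
      ((\<lambda>z. pmf \<mu> z *\<^sub>R T z) has_sum x) UNIV \<longrightarrow> ((\<lambda>z. pmf \<nu> z *\<^sub>R T z) has_sum y) UNIV \<longrightarrow>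
      rel_entropy (mix_pmf t \<mu> \<nu>) w \<le> ereal ((1 - t) * h + t * k - \<delta>)"
    using rel_entropy_mixture_gap_uniform[OF t \<open>x \<noteq> y\<close> _ exp_moments, of "i + j + 1"] ij by auto
  define \<eta> where "\<eta> = min 1 \<delta>"
  have \<eta>: "\<eta> > 0" "\<eta> \<le> 1" "\<eta> \<le> \<delta>" using \<delta> by (auto simp: \<eta>_def)
  obtain \<mu> h where \<mu>: "rel_entropy \<mu> w = ereal h" "h < i + \<eta>" "((\<lambda>z. pmf \<mu> z *\<^sub>R T z) has_sum x) UNIV"
    by (rule contracted_entropy_approx[OF x \<eta>(1)])
  obtain \<nu> k where \<nu>: "rel_entropy \<nu> w = ereal k" "k < j + \<eta>" "((\<lambda>z. pmf \<nu> z *\<^sub>R T z) has_sum y) UNIV"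
    by (rule contracted_entropy_approx[OF y \<eta>(1)])
  have "contracted_entropy w T ((1 - t) *\<^sub>R x + t *\<^sub>R y) \<le> rel_entropy (mix_pmf t \<mu> \<nu>) w"
    unfolding contracted_entropy_def using mix_pmf_moment[OF t \<mu>(3) \<nu>(3)] by (intro INF_lower) simp
  also have "\<dots> \<le> ereal ((1 - t) * h + t * k - \<delta>)"
    using \<mu> \<nu> \<eta> ij by (intro gap[rule_format]) auto
  also have "\<dots> < ereal ((1 - t) * i + t * j)"
  proof -
    have "(1 - t) * h < (1 - t) * (i + \<eta>)" "t * k < t * (j + \<eta>)" using \<mu>(2) \<nu>(2) t by auto
    then have "(1 - t) * h + t * k < (1 - t) * i + t * j + \<eta>" by (simp add: algebra_simps)
    then show ?thesis using \<eta>(3) by simp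
  qed
  finally show ?thesis .
qed

section \<open>Means and exponential moments of the reference distributions\<close>

lemma integrable_pmf_iff_summable:
  fixes f :: "'a \<Rightarrow> real"
  shows "integrable (measure_pmf \<mu>) f \<longleftrightarrow> (\<lambda>z. pmf \<mu> z * f z) summable_on UNIV"
proof -
  have "integrable (measure_pmf \<mu>) f \<longleftrightarrow> integrable (density (count_space UNIV) (pmf \<mu>)) f"
    by (simp only: measure_pmf_eq_density)
  also have "\<dots> \<longleftrightarrow> integrable (count_space UNIV) (\<lambda>z. pmf \<mu> z *\<^sub>R f z)"
    by (rule integrable_density) auto
  also have "\<dots> \<longleftrightarrow> Infinite_Set_Sum.abs_summable_on (\<lambda>z. pmf \<mu> z * f z) UNIV"
    by (simp add: Infinite_Set_Sum.abs_summable_on_def)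
  also have "\<dots> \<longleftrightarrow> (\<lambda>z. pmf \<mu> z * f z) summable_on UNIV"
    by (simp only: abs_summable_equivalent summable_on_iff_abs_summable_on_real)
  finally show ?thesis .
qed

lemma integrable_poisson_exp:
  fixes c r :: real
  assumes "r > 0"
  shows "integrable (measure_pmf (poisson_pmf r)) (\<lambda>k. exp (c * real k))"
proof -
  have "summable (\<lambda>k. exp (- r) * ((r * exp c) ^ k /\<^sub>R fact k))"
    by (intro summable_mult summable_exp_generic)
  also have "(\<lambda>k. exp (- r) * ((r * exp c) ^ k /\<^sub>R fact k)) = (\<lambda>k. pmf (poisson_pmf r) k * exp (c * real k))"
    using assms by (simp add: fun_eq_iff power_mult_distrib exp_of_nat_mult[symmetric] field_simps)
  finally show ?thesis
    unfolding integrable_pmf_iff_summable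
    by (rule summable_nonneg_imp_summable_on) simp
qed

lemma poisson_mean_has_sum:
  assumes "r > 0"
  shows "((\<lambda>k. pmf (poisson_pmf r) k * real k) has_sum r) UNIV"
proof -
  \<comment> \<open>The size bias of a Poisson variable is a shift: \<open>pmf (k + 1) * (k + 1) = r * pmf k\<close>.\<close>
  have "(\<lambda>k. r * pmf (poisson_pmf r) k) sums (r * 1)"
    by (intro sums_mult has_sum_imp_sums pmf_has_sum_1)
  also have "(\<lambda>k. r * pmf (poisson_pmf r) k) = (\<lambda>k. pmf (poisson_pmf r) (Suc k) * real (Suc k))"
    using assms by (simp add: fun_eq_iff divide_simps del: of_nat_Suc)
  finally have "(\<lambda>k. pmf (poisson_pmf r) k * real k) sums (r * 1 + pmf (poisson_pmf r) 0 * real 0)"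
    by (rule sums_Suc)
  then show ?thesis by (intro sums_nonneg_imp_has_sum) simp_all
qed

lemma
  assumes "r > 0"
  shows integrable_poisson_real: "integrable (measure_pmf (poisson_pmf r)) real"
    and expectation_poisson: "measure_pmf.expectation (poisson_pmf r) real = r"
proof -
  show *: "integrable (measure_pmf (poisson_pmf r)) real"
    unfolding integrable_pmf_iff_summable
    using poisson_mean_has_sum[OF assms] by (rule has_sum_imp_summable)
  show "measure_pmf.expectation (poisson_pmf r) real = r"
    using pmf_has_sum_expectation[OF *] poisson_mean_has_sum[OF assms] by (rule has_sum_unique)
qed

lemma has_sum_Pair_iff:
  fixes f :: "'a \<Rightarrow> 'b::real_normed_vector" and g :: "'a \<Rightarrow> 'c::real_normed_vector"
  shows "((\<lambda>z. (f z, g z)) has_sum (x, y)) A \<longleftrightarrow> (f has_sum x) A \<and> (g has_sum y) A"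
proof
  assume h: "((\<lambda>z. (f z, g z)) has_sum (x, y)) A"
  show "(f has_sum x) A \<and> (g has_sum y) A"
    using has_sum_bounded_linear[OF bounded_linear_fst h] has_sum_bounded_linear[OF bounded_linear_snd h]
    by simp
next
  assume h: "(f has_sum x) A \<and> (g has_sum y) A"
  have eq: "sum (\<lambda>z. (f z, g z)) = (\<lambda>F. (sum f F, sum g F))"
    by (auto simp: fun_eq_iff sum_prod)
  show "((\<lambda>z. (f z, g z)) has_sum (x, y)) A"
    unfolding has_sum_def eq using h by (intro tendsto_Pair) (auto simp: has_sum_def)
qed

text \<open>
  Reduces the exponential moments of a vector-valued statistic to those of a scalar that dominates
  its norm. For both reference distributions the number of attempts serves as this scalar.
\<close>
lemma exp_norm_moments:
  fixes T :: "'a \<Rightarrow> 'b::real_normed_vector"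
  assumes "\<And>c :: real. integrable (measure_pmf w) (\<lambda>z. exp (c * f z))"
    and "\<And>z. z \<in> set_pmf w \<Longrightarrow> norm (T z) \<le> C * f z" and "c > 0"
  shows "(\<lambda>z. pmf w z * exp (c * norm (T z))) summable_on UNIV"
proof (rule summable_on_comparison_test)
  show "(\<lambda>z. pmf w z * exp ((c * C) * f z)) summable_on UNIV"
    using assms(1)[of "c * C"] unfolding integrable_pmf_iff_summable .
  show "pmf w z * exp (c * norm (T z)) \<le> pmf w z * exp ((c * C) * f z)" for z
  proof (cases "z \<in> set_pmf w")
    case True
    then have "c * norm (T z) \<le> c * (C * f z)" using assms(2,3) by simp
    then show ?thesis by (intro mult_left_mono) (simp_all add: mult.assoc)
  qed (simp add: set_pmf_iff)
qed simp

lemma pmf_singleton_has_sum: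
  "((\<lambda>g. pmf \<mu> g * of_bool (g = x)) has_sum s) UNIV \<longleftrightarrow> pmf \<mu> x = s"
proof -
  have "((\<lambda>g. pmf \<mu> g * of_bool (g = x)) has_sum pmf \<mu> x) {x}"
    by (rule has_sum_finiteI) auto
  then have *: "((\<lambda>g. pmf \<mu> g * of_bool (g = x)) has_sum pmf \<mu> x) UNIV"
    by (subst has_sum_cong_neutral[where T = "{x}" and g = "\<lambda>g. pmf \<mu> g * of_bool (g = x)"]) auto
  then show ?thesis using has_sum_unique by blast
qed

definition attempts_and_successes :: "nat \<times> nat \<Rightarrow> real \<times> real" where
  "attempts_and_successes z = (real (fst z), real (snd z))"

definition attempts_and_singleton :: "nat \<Rightarrow> real \<times> real" where
  "attempts_and_singleton g = (real g, of_bool (g = 1))"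

lemma poisson_mean:
  assumes "r > 0"
  shows "((\<lambda>g. pmf (poisson_pmf r) g *\<^sub>R attempts_and_singleton g) has_sum (r, r * exp (- r))) UNIV"
proof -
  have "((\<lambda>g. pmf (poisson_pmf r) g * of_bool (g = 1)) has_sum (r * exp (- r))) UNIV"
    unfolding pmf_singleton_has_sum using assms by simp
  then show ?thesis
    using poisson_mean_has_sum[OF assms]
    by (simp add: attempts_and_singleton_def has_sum_Pair_iff)
qed

lemma poisson_exp_moments:
  assumes "r > 0" "c > 0"
  shows "(\<lambda>g. pmf (poisson_pmf r) g * exp (c * norm (attempts_and_singleton g))) summable_on UNIV"
proof (rule exp_norm_moments[where f = real and C = 2])
  show "norm (attempts_and_singleton g) \<le> 2 * real g" for g
  proof -
    have "norm (attempts_and_singleton g) \<le> norm (real g) + norm (of_bool (g = 1) :: real)"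
      unfolding attempts_and_singleton_def by (rule norm_Pair_le)
    then show ?thesis by (cases "g = 1") auto
  qed
qed (use assms integrable_poisson_exp in auto)

text \<open>
  The exponential of the total number of attempts is a product over the independent channels, and the
  number of successes is at most the number of attempts.
\<close>
lemma M_MC_exp_moments:
  fixes b p :: real and \<kappa> :: nat
  assumes "b > 0" "p > 0" "\<kappa> \<ge> 1" "c > 0"
  shows "(\<lambda>z. pmf (M_MC b p \<kappa>) z * exp (c * norm (attempts_and_successes z))) summable_on UNIV"
proof (rule exp_norm_moments[where f = "\<lambda>z. real (fst z)" and C = 2])
  let ?r = "b * p / real \<kappa>"
  have rate_pos: "?r > 0" using assms by auto
  show "integrable (measure_pmf (M_MC b p \<kappa>)) (\<lambda>z. exp (c * real (fst z)))" for c
  proof -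
    have "integrable (measure_pmf (Pi_pmf {1..\<kappa>} 0 (\<lambda>_. poisson_pmf ?r)))
            (\<lambda>X. \<Prod>k\<in>{1..\<kappa>}. exp (c * real (X k)))"
      by (rule integrable_prod_Pi_pmf) (use integrable_poisson_exp[OF rate_pos] in auto)
    then show ?thesis
      unfolding M_MC_def by (simp add: exp_sum sum_distrib_left)
  qed
  show "norm (attempts_and_successes z) \<le> 2 * real (fst z)" if "z \<in> set_pmf (M_MC b p \<kappa>)" for z
  proof -
    have "norm (attempts_and_successes z) \<le> norm (real (fst z)) + norm (real (snd z))"
      unfolding attempts_and_successes_def by (rule norm_Pair_le)
    moreover have "snd z \<le> fst z" using that set_pmf_M_MC by (fastforce simp: Xi_def)
    ultimately show ?thesis by simp
  qed
qed (use assms in simp)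

text \<open>
  Linearity of expectation: each of the \<open>\<kappa>\<close> channels contributes \<open>r\<close> attempts and the success
  probability \<open>r exp (- r)\<close>, where \<open>r = b p / \<kappa>\<close>.
\<close>
lemma M_MC_mean:
  fixes b p :: real and \<kappa> :: nat
  assumes "b > 0" "p > 0" "\<kappa> \<ge> 1"
  shows "((\<lambda>z. pmf (M_MC b p \<kappa>) z *\<^sub>R attempts_and_successes z) has_sum
     (p * b, p * b * exp (- (b * p / real \<kappa>)))) UNIV"
proof -
  let ?r = "b * p / real \<kappa>"
  have rate_pos: "?r > 0" and \<kappa>: "\<kappa> \<ge> 1" using assms by auto
  let ?P = "Pi_pmf {1..\<kappa>} 0 (\<lambda>_. poisson_pmf ?r)"
  have marginal: "integrable (measure_pmf ?P) (\<lambda>X. f (X k)) \<and>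
      measure_pmf.expectation ?P (\<lambda>X. f (X k)) = measure_pmf.expectation (poisson_pmf ?r) f"
    if "integrable (measure_pmf (poisson_pmf ?r)) f" "k \<in> {1..\<kappa>}" for f :: "nat \<Rightarrow> real" and k
  proof -
    have P: "map_pmf (\<lambda>X. X k) ?P = poisson_pmf ?r"
      using that by (subst Pi_pmf_component) auto
    show ?thesis
      using that(1) integrable_map_pmf_eq[of "\<lambda>X. X k" ?P f] integral_map_pmf[of "\<lambda>X. X k" ?P f]
      unfolding P by simp
  qed
  have sum: "integrable (measure_pmf ?P) (\<lambda>X. \<Sum>k=1..\<kappa>. f (X k)) \<and>
      measure_pmf.expectation ?P (\<lambda>X. \<Sum>k=1..\<kappa>. f (X k)) =
        real \<kappa> * measure_pmf.expectation (poisson_pmf ?r) f"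
    if "integrable (measure_pmf (poisson_pmf ?r)) f" for f :: "nat \<Rightarrow> real"
  proof
    show "integrable (measure_pmf ?P) (\<lambda>X. \<Sum>k=1..\<kappa>. f (X k))"
      using marginal[OF that] by (intro Bochner_Integration.integrable_sum) blast
    show "measure_pmf.expectation ?P (\<lambda>X. \<Sum>k=1..\<kappa>. f (X k)) =
        real \<kappa> * measure_pmf.expectation (poisson_pmf ?r) f"
      using marginal[OF that] by (subst Bochner_Integration.integral_sum) simp_all
  qed
  let ?s = "\<lambda>k. of_bool (k = 1) :: real"
  have s: "integrable (measure_pmf (poisson_pmf ?r)) ?s"
    by (rule measure_pmf.integrable_const_bound[where B = 1]) auto
  have Es: "measure_pmf.expectation (poisson_pmf ?r) ?s = ?r * exp (- ?r)"
    using pmf_has_sum_expectation[OF s, unfolded pmf_singleton_has_sum] rate_pos by simp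
  have "integrable (measure_pmf (M_MC b p \<kappa>)) (\<lambda>z. real (fst z))"
    "measure_pmf.expectation (M_MC b p \<kappa>) (\<lambda>z. real (fst z)) = p * b"
    using sum[OF integrable_poisson_real[OF rate_pos]] expectation_poisson[OF rate_pos] \<kappa>
    by (simp_all add: M_MC_def mult.commute)
  moreover have "integrable (measure_pmf (M_MC b p \<kappa>)) (\<lambda>z. real (snd z))"
    "measure_pmf.expectation (M_MC b p \<kappa>) (\<lambda>z. real (snd z)) = p * b * exp (- ?r)"
    using sum[OF s] Es \<kappa> by (simp_all add: M_MC_def mult.commute)
  ultimately show ?thesis
    using pmf_has_sum_expectation[of "M_MC b p \<kappa>" "\<lambda>z. real (fst z)"]
      pmf_has_sum_expectation[of "M_MC b p \<kappa>" "\<lambda>z. real (snd z)"]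
    by (simp add: attempts_and_successes_def has_sum_Pair_iff)
qed

section \<open>The two rate functions as minimal entropies\<close>

text \<open>
  The restriction to distributions on \<open>Xi \<kappa>\<close> costs nothing, since all others have infinite entropy with
  respect to \<open>M_MC\<close>, which lives on \<open>Xi \<kappa>\<close>.
\<close>
lemma I_LMC_eq: "I_LMC b p \<kappa> x = contracted_entropy (M_MC b p \<kappa>) attempts_and_successes x"
proof -
  obtain a s where x: "x = (a, s)" by fastforce
  let ?M = "M_MC b p \<kappa>"
  have feasible: "((\<lambda>(i, j). pmf \<nu> (i, j) * real i) has_sum a) (Xi \<kappa>) \<and>
      ((\<lambda>(i, j). pmf \<nu> (i, j) * real j) has_sum s) (Xi \<kappa>) \<longleftrightarrow>
      ((\<lambda>z. pmf \<nu> z *\<^sub>R attempts_and_successes z) has_sum x) UNIV"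
    if "set_pmf \<nu> \<subseteq> Xi \<kappa>" for \<nu>
  proof -
    have zero: "pmf \<nu> z = 0" if "z \<notin> Xi \<kappa>" for z
      using \<open>set_pmf \<nu> \<subseteq> Xi \<kappa>\<close> that by (auto simp: set_pmf_iff)
    have "((\<lambda>(i, j). pmf \<nu> (i, j) * real i) has_sum a) (Xi \<kappa>) \<longleftrightarrow>
        ((\<lambda>z. pmf \<nu> z * real (fst z)) has_sum a) UNIV"
      by (rule has_sum_cong_neutral) (auto simp: zero)
    moreover have "((\<lambda>(i, j). pmf \<nu> (i, j) * real j) has_sum s) (Xi \<kappa>) \<longleftrightarrow>
        ((\<lambda>z. pmf \<nu> z * real (snd z)) has_sum s) UNIV"
      by (rule has_sum_cong_neutral) (auto simp: zero)
    ultimately show ?thesis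
      by (simp add: x attempts_and_successes_def has_sum_Pair_iff)
  qed
  have infinite: "rel_entropy \<nu> ?M = \<infinity>" if "\<not> set_pmf \<nu> \<subseteq> Xi \<kappa>" for \<nu>
    using that set_pmf_M_MC[of b p \<kappa>] by (auto simp: rel_entropy_def)
  show ?thesis
  proof (rule antisym)
    show "I_LMC b p \<kappa> x \<le> contracted_entropy ?M attempts_and_successes x"
      unfolding contracted_entropy_def
    proof (rule INF_greatest)
      fix \<nu> assume \<nu>: "\<nu> \<in> {\<nu>. ((\<lambda>z. pmf \<nu> z *\<^sub>R attempts_and_successes z) has_sum x) UNIV}"
      show "I_LMC b p \<kappa> x \<le> rel_entropy \<nu> ?M"
      proof (cases "set_pmf \<nu> \<subseteq> Xi \<kappa>")
        case True
        have "((\<lambda>z. pmf \<nu> z *\<^sub>R attempts_and_successes z) has_sum x) UNIV"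
          using \<nu> by (rule CollectD)
        with feasible[OF True] True show ?thesis
          unfolding I_LMC_def x prod.case by (intro INF_lower CollectI conjI) simp_all
      qed (simp add: infinite)
    qed
    show "contracted_entropy ?M attempts_and_successes x \<le> I_LMC b p \<kappa> x"
      unfolding I_LMC_def contracted_entropy_def x prod.case
    proof (rule INF_superset_mono)
      show "{\<nu>. set_pmf \<nu> \<subseteq> Xi \<kappa> \<and>
              ((\<lambda>(i, j). pmf \<nu> (i, j) * real i) has_sum a) (Xi \<kappa>) \<and>
              ((\<lambda>(i, j). pmf \<nu> (i, j) * real j) has_sum s) (Xi \<kappa>)}
          \<subseteq> {\<nu>. ((\<lambda>z. pmf \<nu> z *\<^sub>R attempts_and_successes z) has_sum (a, s)) UNIV}"
        using feasible[unfolded x] by blast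
    qed simp
  qed
qed

text \<open>
  The part of the global rate function that depends on \<open>a\<close> alone, in the normal form that makes its
  convexity visible: it compares the idle mass \<open>b - a\<close> with its typical value \<open>b (1 - p)\<close>. The second
  case is the limit for \<open>p\<close> tending to \<open>1\<close>.
\<close>
definition idle_cost :: "real \<Rightarrow> real \<Rightarrow> real \<Rightarrow> ereal" where
  "idle_cost b p a =
     (if p < 1 then ereal (kl_term (b - a) (b * (1 - p))) else if a = b then 0 else \<infinity>)"

lemma idle_cost_nonneg:
  assumes "b > 0" "a \<le> b"
  shows "idle_cost b p a \<ge> 0"
  using assms kl_term_nonneg[of "b - a" "b * (1 - p)"] by (auto simp: idle_cost_def)

lemma idle_cost_convex:
  assumes "b > 0" "a \<le> b" "a' \<le> b" "0 < t" "t < 1"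
    and v: "idle_cost b p a = ereal v" and v': "idle_cost b p a' = ereal v'"
  shows "idle_cost b p ((1 - t) * a + t * a') \<le> ereal ((1 - t) * v + t * v')"
proof (cases "p < 1")
  case True
  have "(1 - t) * (b - a) + t * (b - a') = b - ((1 - t) * a + t * a')"
    by (simp add: algebra_simps)
  then show ?thesis
    using True kl_term_convex[of t "b - a" "b - a'" "b * (1 - p)"] assms
    by (simp add: idle_cost_def)
next
  case False
  then have "a = b" "a' = b" "v = 0" "v' = 0"
    using v v' by (auto simp: idle_cost_def zero_ereal_def split: if_splits)
  moreover have "(1 - t) * b + t * b = b" by (simp add: algebra_simps)
  ultimately show ?thesis using False by (simp add: idle_cost_def)
qed

text \<open>
  For \<open>p < 1\<close> the linear term \<open>a - b p\<close> is the correction \<open>- (b - a) + b (1 - p)\<close> that turns the logarithmic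
  term into \<open>kl_term (b - a) (b (1 - p))\<close>, also at \<open>a = b\<close>, where the logarithmic term is \<open>0\<close>.
\<close>
lemma I_GMC_eq:
  assumes "b > 0" "p \<le> 1" "a \<le> b"
  shows "I_GMC b p \<kappa> (a, s) =
    ereal (real \<kappa>) * contracted_entropy (poisson_pmf (b * p / real \<kappa>)) attempts_and_singleton
      ((1 / real \<kappa>) *\<^sub>R (a, s)) + idle_cost b p a"
proof -
  let ?J = "contracted_entropy (poisson_pmf (b * p / real \<kappa>)) attempts_and_singleton
      ((1 / real \<kappa>) *\<^sub>R (a, s))"
  have J: "(INF \<mu> \<in> {\<mu>. ((\<lambda>g. pmf \<mu> g * real g) has_sum (a / real \<kappa>)) UNIV \<and> pmf \<mu> 1 = s / real \<kappa>}.
        rel_entropy \<mu> (poisson_pmf (b * p / real \<kappa>))) = ?J"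
    by (simp add: contracted_entropy_def attempts_and_singleton_def has_sum_Pair_iff
        pmf_singleton_has_sum)
  consider "p < 1" "a = b" | "p < 1" "a < b" | "p = 1" "a = b" | "p = 1" "a < b"
    using assms by fastforce
  then have cost: "ereal (a - b * p) + (if a = b then 0 else if p = 1 then \<infinity>
      else ereal ((b - a) * ln ((1 - a / b) / (1 - p)))) = idle_cost b p a"
  proof cases
    case 1
    have "kl_term 0 (b * (1 - p)) = b - b * p"
      by (simp add: kl_term_def right_diff_distrib)
    then show ?thesis using 1 by (simp add: idle_cost_def)
  next
    case 2
    have "(1 - a / b) / (1 - p) = (b - a) / (b * (1 - p))"
      using assms(1) by (simp add: diff_divide_distrib)
    then have "kl_term (b - a) (b * (1 - p)) = a - b * p + (b - a) * ln ((1 - a / b) / (1 - p))"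
      unfolding kl_term_def by (simp add: right_diff_distrib)
    then show ?thesis using 2 by (simp add: idle_cost_def)
  qed (simp_all add: idle_cost_def)
  then show ?thesis
    unfolding I_GMC_def prod.case J add.assoc cost using assms(3) by simp
qed

section \<open>Strict convexity and the unique minimizer\<close>

text \<open>
  If \<open>x \<noteq> m\<close> were a second zero, then strict convexity would give a negative value at the midpoint.
\<close>
lemma strictly_convex_with_unique_zero:
  assumes strict: "\<And>x y i j t. x \<in> quadrant \<Longrightarrow> y \<in> quadrant \<Longrightarrow> I x = ereal i \<Longrightarrow> I y = ereal j \<Longrightarrow>
      x \<noteq> y \<Longrightarrow> 0 < t \<Longrightarrow> t < 1 \<Longrightarrow> I ((1 - t) *\<^sub>R x + t *\<^sub>R y) < ereal ((1 - t) * i + t * j)"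
    and nonneg: "\<And>x. I x \<ge> 0" and m: "m \<in> quadrant" "I m = 0"
  shows "strictly_convex_on (finite_domain I) I \<and> has_unique_minimizer I m"
proof
  have quadrant: "convex quadrant" by (intro convex_Times) auto
  have finite: "\<exists>i. I x = ereal i" if "x \<in> finite_domain I" for x
    using that nonneg[of x] by (cases "I x") (auto simp: finite_domain_def)
  have lt: "I ((1 - t) *\<^sub>R x + t *\<^sub>R y) < ereal (1 - t) * I x + ereal t * I y"
    if xy: "x \<in> finite_domain I" "y \<in> finite_domain I" and t: "x \<noteq> y" "0 < t" "t < 1" for x y t
  proof -
    obtain i j where ij: "I x = ereal i" "I y = ereal j"
      using finite xy by blast
    have "x \<in> quadrant" "y \<in> quadrant" using xy by (simp_all only: finite_domain_def mem_Collect_eq)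
    from strict[OF this ij t] show ?thesis by (simp add: ij)
  qed
  have "convex (finite_domain I)"
    unfolding convex_alt
  proof (intro ballI allI impI)
    fix x y and t :: real
    assume xy: "x \<in> finite_domain I" "y \<in> finite_domain I" and t: "0 \<le> t \<and> t \<le> 1"
    consider "x = y" | "t = 0" | "t = 1" | "x \<noteq> y" "0 < t" "t < 1" using t by fastforce
    then show "(1 - t) *\<^sub>R x + t *\<^sub>R y \<in> finite_domain I"
    proof cases
      case 1
      then show ?thesis using xy by (simp add: scaleR_add_left[symmetric])
    next
      case 4
      have "(1 - t) *\<^sub>R x + t *\<^sub>R y \<in> quadrant"
        using quadrant xy t unfolding convex_alt finite_domain_def by blast
      moreover obtain i j where "I x = ereal i" "I y = ereal j"
        using finite xy by blast
      with lt[OF xy 4] have "I ((1 - t) *\<^sub>R x + t *\<^sub>R y) < ereal ((1 - t) * i + t * j)"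
        by simp
      then have "I ((1 - t) *\<^sub>R x + t *\<^sub>R y) < \<infinity>"
        by (rule less_trans) simp
      ultimately show ?thesis by (simp add: finite_domain_def)
    qed (use xy in simp_all)
  qed
  then show "strictly_convex_on (finite_domain I) I"
    using lt by (auto simp: strictly_convex_on_def)
  have "x = m" if "x \<in> quadrant" "I x = 0" for x
  proof (rule ccontr)
    assume "x \<noteq> m"
    then have "I ((1 - 1 / 2) *\<^sub>R x + (1 / 2) *\<^sub>R m) < ereal ((1 - 1 / 2) * 0 + 1 / 2 * 0)"
      using that m by (intro strict) (auto simp: zero_ereal_def)
    then show False using nonneg by (simp add: zero_ereal_def[symmetric] leD)
  qed
  moreover have "is_arg_min I (\<lambda>y. y \<in> quadrant) x \<longleftrightarrow> x \<in> quadrant \<and> I x = 0" for x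
  proof
    assume "is_arg_min I (\<lambda>y. y \<in> quadrant) x"
    then have "x \<in> quadrant" "\<not> I m < I x" using m(1) unfolding is_arg_min_def by blast+
    then show "x \<in> quadrant \<and> I x = 0" using nonneg[of x] m(2) by (simp only: not_less antisym)
  next
    assume "x \<in> quadrant \<and> I x = 0"
    then show "is_arg_min I (\<lambda>y. y \<in> quadrant) x"
      using nonneg by (simp only: is_arg_min_def) (simp add: not_less)
  qed
  ultimately show "has_unique_minimizer I m"
    using m unfolding has_unique_minimizer_def by blast
qed

theorem corollary1p13:
  fixes b p :: real and \<kappa> :: nat
  assumes "b > 0" and "p > 0" and "\<kappa> \<ge> 1"
  shows "(strictly_convex_on (finite_domain (I_LMC b p \<kappa>)) (I_LMC b p \<kappa>) \<and>
          has_unique_minimizer (I_LMC b p \<kappa>) (p * b, p * b * exp (- (b * p / real \<kappa>)))) \<and>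
         (p \<le> 1 \<longrightarrow>
          strictly_convex_on (finite_domain (I_GMC b p \<kappa>)) (I_GMC b p \<kappa>) \<and>
          has_unique_minimizer (I_GMC b p \<kappa>) (p * b, p * b * exp (- (b * p / real \<kappa>))))"
proof (intro conjI[OF strictly_convex_with_unique_zero] impI)
  let ?m = "(p * b, p * b * exp (- (b * p / real \<kappa>)))"
  show m: "?m \<in> quadrant" using assms by simp
  let ?M = "M_MC b p \<kappa>"
  show "I_LMC b p \<kappa> ((1 - t) *\<^sub>R x + t *\<^sub>R y) < ereal ((1 - t) * i + t * j)"
    if "I_LMC b p \<kappa> x = ereal i" "I_LMC b p \<kappa> y = ereal j" "x \<noteq> y" "0 < t" "t < 1" for x y i j t
    using contracted_entropy_strict_convex[where w = ?M and T = attempts_and_successes and x = x and y = y]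
      M_MC_exp_moments[OF assms] that by (simp add: I_LMC_eq)
  show "I_LMC b p \<kappa> x \<ge> 0" for x
    by (simp add: I_LMC_eq contracted_entropy_nonneg)
  show "I_LMC b p \<kappa> ?m = 0"
    unfolding I_LMC_eq using M_MC_mean[OF assms] by (rule contracted_entropy_mean)
next
  assume p: "p \<le> 1"
  let ?m = "(p * b, p * b * exp (- (b * p / real \<kappa>)))"
  define r where "r = b * p / real \<kappa>"
  have r: "r > 0" using assms by (simp add: r_def)
  define J where "J = contracted_entropy (poisson_pmf r) attempts_and_singleton"
  define c where "c = 1 / real \<kappa>"
  have \<kappa>: "real \<kappa> > 0" and c: "c > 0" using assms by (simp_all add: c_def)
  have G: "I_GMC b p \<kappa> (a, s) = ereal (real \<kappa>) * J (c *\<^sub>R (a, s)) + idle_cost b p a"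
    if "a \<le> b" for a s
    using I_GMC_eq[OF assms(1) p that] unfolding J_def r_def c_def .
  have J0: "J x \<ge> 0" for x unfolding J_def by (rule contracted_entropy_nonneg)
  show "strictly_convex_on (finite_domain (I_GMC b p \<kappa>)) (I_GMC b p \<kappa>) \<and>
      has_unique_minimizer (I_GMC b p \<kappa>) ?m"
  proof (rule strictly_convex_with_unique_zero)
    show "?m \<in> quadrant" using assms by simp
    show "I_GMC b p \<kappa> x \<ge> 0" for x
    proof (cases x)
      case (Pair a s)
      show ?thesis
      proof (cases "a \<le> b")
        case True
        then show ?thesis
          using J0 \<kappa> idle_cost_nonneg[OF assms(1) True] by (simp add: Pair G)
      qed (simp add: Pair I_GMC_def)
    qed
    show "I_GMC b p \<kappa> ?m = 0"
    proof -
      have "c *\<^sub>R ?m = (r, r * exp (- r))" by (simp add: c_def r_def mult.commute)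
      then have "J (c *\<^sub>R ?m) = 0"
        unfolding J_def using poisson_mean[OF r] by (simp add: contracted_entropy_mean)
      moreover have "idle_cost b p (p * b) = 0"
      proof (cases "p < 1")
        case True
        have "b - p * b = b * (1 - p)" by (simp add: algebra_simps)
        then show ?thesis using True by (simp add: idle_cost_def zero_ereal_def)
      qed (use p in \<open>simp add: idle_cost_def\<close>)
      moreover have "p * b \<le> b" using assms p by simp
      ultimately show ?thesis by (simp add: G)
    qed
    fix x y i j t
    assume x: "I_GMC b p \<kappa> x = ereal i" and y: "I_GMC b p \<kappa> y = ereal j"
      and "x \<noteq> y" and t: "0 < t" "t < (1::real)"
    have decompose: "\<exists>k v. fst z \<le> b \<and> J (c *\<^sub>R z) = ereal k \<and> idle_cost b p (fst z) = ereal v \<and>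
        h = real \<kappa> * k + v" if h: "I_GMC b p \<kappa> z = ereal h" for z h
    proof -
      obtain a s where z: "z = (a, s)" by fastforce
      have a: "a \<le> b" using h by (auto simp: z I_GMC_def split: if_splits)
      show ?thesis
        using h J0[of "c *\<^sub>R z"] idle_cost_nonneg[OF assms(1) a, of p] \<kappa> a
        by (cases "J (c *\<^sub>R z)"; cases "idle_cost b p a") (auto simp: z G)
    qed
    obtain k v where x': "fst x \<le> b" "J (c *\<^sub>R x) = ereal k" "idle_cost b p (fst x) = ereal v"
      "i = real \<kappa> * k + v" using decompose[OF x] by blast
    obtain l u where y': "fst y \<le> b" "J (c *\<^sub>R y) = ereal l" "idle_cost b p (fst y) = ereal u"
      "j = real \<kappa> * l + u" using decompose[OF y] by blast
    define z where "z = (1 - t) *\<^sub>R x + t *\<^sub>R y"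
    have fz: "fst z = (1 - t) * fst x + t * fst y" by (simp add: z_def)
    have "(1 - t) * fst x \<le> (1 - t) * b" "t * fst y \<le> t * b"
      using x'(1) y'(1) t by simp_all
    then have zb: "fst z \<le> b" unfolding fz by (simp add: algebra_simps)
    have cz: "c *\<^sub>R z = (1 - t) *\<^sub>R (c *\<^sub>R x) + t *\<^sub>R (c *\<^sub>R y)"
      by (simp add: z_def scaleR_add_right mult.commute)
    have "J (c *\<^sub>R z) < ereal ((1 - t) * k + t * l)"
      unfolding cz J_def
      by (rule contracted_entropy_strict_convex)
        (use poisson_exp_moments[OF r] x' y' t c \<open>x \<noteq> y\<close> in \<open>auto simp: J_def\<close>)
    then obtain n where n: "J (c *\<^sub>R z) = ereal n" "n < (1 - t) * k + t * l"
      using J0[of "c *\<^sub>R z"] by (cases "J (c *\<^sub>R z)") auto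
    have "idle_cost b p (fst z) \<le> ereal ((1 - t) * v + t * u)"
      unfolding fz using assms(1) x' y' t by (intro idle_cost_convex) auto
    then obtain q where q: "idle_cost b p (fst z) = ereal q" "q \<le> (1 - t) * v + t * u"
      using idle_cost_nonneg[OF assms(1) zb, of p] by (cases "idle_cost b p (fst z)") auto
    have "I_GMC b p \<kappa> z = ereal (real \<kappa> * n + q)"
      using G[OF zb, of "snd z"] n q by simp
    moreover have "real \<kappa> * n < real \<kappa> * ((1 - t) * k + t * l)"
      using n(2) \<kappa> by simp
    then have "real \<kappa> * n + q < (1 - t) * i + t * j"
      using q(2) x'(4) y'(4) by (simp add: algebra_simps)
    ultimately show "I_GMC b p \<kappa> ((1 - t) *\<^sub>R x + t *\<^sub>R y) < ereal ((1 - t) * i + t * j)"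
      by (simp add: z_def)
  qed
qed

end
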